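(* Let $T_{meas}=t_{soil}+T_{(sl)}$ be the satellite's measurement, where $t_{soil}$ is a deterministic real number and $T_{(sl)}$ is the side-lobe RFI brightness temperature, and let $\hat T_{soil}=T_{meas}-\mathbb{E}[T_{(sl)}]$ be the corrected measurement, with error $Err=\hat T_{soil}-t_{soil}$. For $\tau>0$ let $SOP(\tau)=\mathbb{P}(|Err|>\tau)$ be the sensing outage probability. Then for every $\tau>0$ and every even positive integer $n$, $$SOP(\tau)=\mathbb{P}\left(|T_{(sl)}-\mathbb{E}[T_{(sl)}]|>\tau\right)<\frac{\mu_n}{\tau^n},$$ where $\mu_n=\mathbb{E}\left[(T_{(sl)}-\mathbb{E}[T_{(sl)}])^n\right]$ is the $n$th central moment of $T_{(sl)}$.
   Context: Constants $\omega>0$, $\alpha>2$, $\lambda_c>0$, $\lambda_{BS}>0$, $g_{(sl)}>0$, $h>r_e>0$ are given. The Earth is the sphere of radius $r_e$ centered at the origin of $\mathbb{R}^3$ and the satellite is at $\mathbf{h}=(0,0,h)$. The exposed cap is $\mathcal{B}=\{\mathbf{x}:\|\mathbf{x}\|=r_e,\ \frac{\mathbf{x}\cdot\mathbf{h}}{\|\mathbf{x}\|\|\mathbf{h}\|}\ge\frac{r_e}{h}\}$; the side-lobe region is a measurable set $\mathcal{B}_{(sl)}\subseteq\mathcal{B}$ of positive area (the cap minus the main-lobe footprint), and $\Psi_{(sl)}$ is a homogeneous Poisson point process on $\mathcal{B}_{(sl)}$ with intensity $\lambda_c$ per unit area. $T_{(sl)}=\sum_{\mathbf{X}_i\in\Psi_{(sl)}}\sum_{j=1}^{N_i}g_{(sl)}\omega|H_{ij}|^2\|\mathbf{X}_i-\mathbf{h}\|^{-\alpha}$,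 with $N_i\sim\mathrm{Pois}(\lambda_{BS})$ i.i.d., channel power gains $|H_{ij}|^2$ i.i.d., and $\Psi_{(sl)}$, the $N_i$ and the $|H_{ij}|^2$ independent. The channel is either Rayleigh ($|H|^2$ exponential with mean $2b_0>0$) or shadowed Rician with parameters $(\Omega,2b_0,m)$, $b_0,m,\Omega>0$ ($|H|^2$ has density $\frac{1}{2b_0}\left(\frac{2b_0m}{2b_0m+\Omega}\right)^m e^{-t/(2b_0)}\,{}_1F_1\left(m;1;\frac{\Omega t}{2b_0(2b_0m+\Omega)}\right)$ on $t>0$). RFI on the main lobe is assumed to be absent. *)

theory Defs
  imports "HOL-Probability.Probability"
begin

section \<open>Geometry\<close>

definition satellite :: "real \<Rightarrow> real ^ 3" where
  "satellite h = vector [0, 0, h]"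

definition exposed_cap :: "real \<Rightarrow> real \<Rightarrow> (real ^ 3) set" where
  "exposed_cap r h =
     {x. norm x = r \<and> (x \<bullet> satellite h) / (norm x * norm (satellite h)) \<ge> r / h}"

definition sphere_point :: "real \<Rightarrow> real \<times> real \<Rightarrow> real ^ 3" where
  "sphere_point r = (\<lambda>(\<theta>, \<phi>).
     vector [r * sin \<theta> * cos \<phi>, r * sin \<theta> * sin \<phi>, r * cos \<theta>])"

text \<open>Surface area on the sphere of radius \<open>r\<close> around the origin: the area element
  \<open>r\<^sup>2 sin \<theta> d\<theta> d\<phi>\<close> of spherical coordinates (colatitude \<open>\<theta>\<close>, longitude \<open>\<phi>\<close>),
  pushed forward to a Borel measure on the ambient space.\<close>

definition sphere_area :: "real \<Rightarrow> (real ^ 3) measure" where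
  "sphere_area r =
     distr
       (density lborel
         (\<lambda>(\<theta>, \<phi>). ennreal (r\<^sup>2 * sin \<theta>) * indicator ({0..pi} \<times> {0..2 * pi}) (\<theta>, \<phi>)))
       borel (sphere_point r)"

lemma sphere_point_measurable [measurable]: "sphere_point r \<in> borel_measurable borel"
proof -
  have "continuous_on UNIV (\<lambda>p. sphere_point r p $ i)" for i
    using exhaust_3[of i]
    by (elim disjE; simp add: sphere_point_def case_prod_unfold vector_3; intro continuous_intros)
  then have "continuous_on UNIV (\<lambda>p. \<chi> i. sphere_point r p $ i)"
    by (intro continuous_on_vec_lambda)
  then show ?thesis by (intro borel_measurable_continuous_onI) simp
qed

lemma emeasure_sphere_area_UNIV: "emeasure (sphere_area r) UNIV = ennreal (4 * pi * r\<^sup>2)"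
proof -
  have m1: "(\<lambda>p::real \<times> real. ennreal (r\<^sup>2 * sin (fst p)) * indicator ({0..pi} \<times> {0..2 * pi}) p)
      \<in> borel_measurable (lborel \<Otimes>\<^sub>M lborel)"
  proof -
    have "indicator ({0..pi} \<times> {0..2 * pi}) 
        \<in> (borel_measurable borel :: (real \<times> real \<Rightarrow> ennreal) set)"
      by (intro borel_measurable_indicator borel_closed closed_Times) auto
    moreover have "(\<lambda>p::real \<times> real. ennreal (r\<^sup>2 * sin (fst p))) \<in> borel_measurable borel"
      by (intro measurable_compose[OF _ measurable_ennreal] borel_measurable_continuous_onI
            continuous_intros)
    ultimately show ?thesis
      unfolding lborel_prod by (simp add: borel_measurable_times_ennreal)
  qed
  have "((\<lambda>\<theta>. r\<^sup>2 * sin \<theta>) has_integral (- r\<^sup>2 * cos pi - (- r\<^sup>2 * cos 0))) {0..pi}"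
    by (rule fundamental_theorem_of_calculus)
       (auto intro!: derivative_eq_intros simp flip: has_real_derivative_iff_has_vector_derivative)
  then have "(\<integral>\<^sup>+\<theta>. ennreal (r\<^sup>2 * sin \<theta>) * indicator {0..pi} \<theta> \<partial>lborel) = ennreal (2 * r\<^sup>2)"
    by (subst nn_integral_has_integral_lebesgue') (auto simp: sin_ge_zero)
  then have i: "(\<integral>\<^sup>+\<theta>. ennreal (r\<^sup>2 * sin \<theta>) * indicator {0..pi} \<theta> * ennreal (2 * pi) \<partial>lborel)
      = ennreal (4 * pi * r\<^sup>2)"
    by (subst nn_integral_multc) (auto simp flip: ennreal_mult simp: mult_ac)
  have "emeasure (sphere_area r) UNIV =
      (\<integral>\<^sup>+p. ennreal (r\<^sup>2 * sin (fst p)) * indicator ({0..pi} \<times> {0..2 * pi}) p \<partial>(lborel \<Otimes>\<^sub>M lborel))"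
    using m1 unfolding sphere_area_def case_prod_unfold lborel_prod
    by (subst emeasure_distr) (simp_all add: emeasure_density)
  also have "\<dots> = (\<integral>\<^sup>+\<theta>. \<integral>\<^sup>+\<phi>. ennreal (r\<^sup>2 * sin \<theta>) * indicator {0..pi} \<theta> * indicator {0..2 * pi} \<phi> \<partial>lborel \<partial>lborel)"
    unfolding lborel.nn_integral_fst[OF m1, symmetric]
    by (intro nn_integral_cong) (simp split: split_indicator)
  also have "\<dots> = (\<integral>\<^sup>+\<theta>. ennreal (r\<^sup>2 * sin \<theta>) * indicator {0..pi} \<theta> * ennreal (2 * pi) \<partial>lborel)"
    by (simp add: nn_integral_cmult)
  finally show ?thesis using i by simp
qed

lemma finite_measure_sphere_area: "finite_measure (sphere_area r)"
proof
  have "space (sphere_area r) = UNIV" by (simp add: sphere_area_def)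
  then show "emeasure (sphere_area r) (space (sphere_area r)) \<noteq> \<infinity>"
    by (simp add: emeasure_sphere_area_UNIV)
qed


section \<open>Homogeneous Poisson point process on a part of the sphere\<close>

text \<open>The point process is given by a measurable enumeration: at the outcome \<open>w\<close> its points are
  \<open>X 0 w, \<dots>, X (K w - 1) w\<close>, and the values \<open>X i w\<close> for \<open>i \<ge> K w\<close> are irrelevant.
  Finitely many points suffice because the sphere has finite area.\<close>

definition point_count :: "('w \<Rightarrow> nat) \<Rightarrow> (nat \<Rightarrow> 'w \<Rightarrow> 'a) \<Rightarrow> 'a set \<Rightarrow> 'w \<Rightarrow> nat" where
  "point_count K X A w = card {i. i < K w \<and> X i w \<in> A}"

text \<open>The Poisson probabilities are written out because \<^const>\<open>poisson_pmf\<close> is specified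
  for positive rates only, whereas \<open>A\<close> may have area zero.\<close>

definition homogeneous_ppp ::
  "'w measure \<Rightarrow> real \<Rightarrow> (real ^ 3) set \<Rightarrow> real \<Rightarrow> ('w \<Rightarrow> nat) \<Rightarrow> (nat \<Rightarrow> 'w \<Rightarrow> real ^ 3) \<Rightarrow> bool"
  where
  "homogeneous_ppp M r B c K X \<longleftrightarrow>
     K \<in> measurable M (count_space UNIV) \<and>
     (\<forall>i. X i \<in> borel_measurable M) \<and>
     (\<forall>w\<in>space M. \<forall>i<K w. X i w \<in> B) \<and>
     (\<forall>A\<in>sets borel. A \<subseteq> B \<longrightarrow>
        (\<forall>k. measure M {w \<in> space M. point_count K X A w = k} =
             (c * measure (sphere_area r) A) ^ k / fact k
               * exp (- (c * measure (sphere_area r) A)))) \<and>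
     (\<forall>\<A>. finite \<A> \<and> disjoint \<A> \<and> \<A> \<subseteq> sets borel \<and> (\<forall>A\<in>\<A>. A \<subseteq> B) \<longrightarrow>
        prob_space.indep_vars M (\<lambda>_. count_space UNIV) (point_count K X) \<A>)"


section \<open>Channel models\<close>

definition hyp1F1 :: "real \<Rightarrow> real \<Rightarrow> real \<Rightarrow> real" where
  "hyp1F1 a b x = (\<Sum>k. pochhammer a k / pochhammer b k * x ^ k / fact k)"

text \<open>The parameters are \<open>b0\<close>, resp. \<open>\<Omega>\<close>, \<open>b0\<close>, \<open>m\<close>.\<close>

datatype channel = Rayleigh real | Shadowed_Rician real real real

fun valid_channel :: "channel \<Rightarrow> bool" where
  "valid_channel (Rayleigh b0) \<longleftrightarrow> b0 > 0"
| "valid_channel (Shadowed_Rician \<Omega> b0 m) \<longleftrightarrow> \<Omega> > 0 \<and> b0 > 0 \<and> m > 0"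

fun power_gain_density :: "channel \<Rightarrow> real \<Rightarrow> real" where
  "power_gain_density (Rayleigh b0) t = exponential_density (1 / (2 * b0)) t"
| "power_gain_density (Shadowed_Rician \<Omega> b0 m) t =
     (if t > 0
      then 1 / (2 * b0) * (2 * b0 * m / (2 * b0 * m + \<Omega>)) powr m * exp (- t / (2 * b0))
             * hyp1F1 m 1 (\<Omega> * t / (2 * b0 * (2 * b0 * m + \<Omega>)))
      else 0)"

definition power_gain :: "(nat \<Rightarrow> nat \<Rightarrow> 'w \<Rightarrow> complex) \<Rightarrow> nat \<Rightarrow> nat \<Rightarrow> 'w \<Rightarrow> real" where
  "power_gain H i j w = (cmod (H i j w))\<^sup>2"


section \<open>Independence of the point process, the numbers and the gains\<close>

datatype source = Points | Num nat | Gain nat nat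

text \<open>Joint independence of the point process (with its enumeration, so that the marks are
  independent of the labelling of the points), of all \<open>N i\<close> and of all \<open>|H i j|\<^sup>2\<close>.  The
  \<sigma>-algebras generated by these random variables are used since the value types differ.\<close>

fun source_events ::
  "'w measure \<Rightarrow> ('w \<Rightarrow> nat) \<Rightarrow> (nat \<Rightarrow> 'w \<Rightarrow> real ^ 3) \<Rightarrow> (nat \<Rightarrow> 'w \<Rightarrow> nat) \<Rightarrow>
    (nat \<Rightarrow> nat \<Rightarrow> 'w \<Rightarrow> complex) \<Rightarrow> source \<Rightarrow> 'w set set" where
  "source_events M K X N H Points =
     sets (vimage_algebra (space M) (\<lambda>w. (K w, \<lambda>i. X i w))
            (count_space UNIV \<Otimes>\<^sub>M (\<Pi>\<^sub>M i\<in>UNIV. borel)))"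
| "source_events M K X N H (Num i) =
     sets (vimage_algebra (space M) (N i) (count_space UNIV))"
| "source_events M K X N H (Gain i j) =
     sets (vimage_algebra (space M) (power_gain H i j) borel)"


section \<open>Side-lobe interference and sensing outage\<close>

definition sidelobe_rfi ::
  "real \<Rightarrow> real \<Rightarrow> real \<Rightarrow> real \<Rightarrow> ('w \<Rightarrow> nat) \<Rightarrow> (nat \<Rightarrow> 'w \<Rightarrow> real ^ 3) \<Rightarrow> (nat \<Rightarrow> 'w \<Rightarrow> nat) \<Rightarrow>
    (nat \<Rightarrow> nat \<Rightarrow> 'w \<Rightarrow> complex) \<Rightarrow> 'w \<Rightarrow> real" where
  "sidelobe_rfi g \<omega> \<alpha> h K X N H w =
     (\<Sum>i<K w. \<Sum>j<N i w.
        g * \<omega> * power_gain H i j w * norm (X i w - satellite h) powr (- \<alpha>))"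

definition measurement :: "real \<Rightarrow> ('w \<Rightarrow> real) \<Rightarrow> 'w \<Rightarrow> real" where
  "measurement t_soil T w = t_soil + T w"

definition corrected_measurement :: "'w measure \<Rightarrow> real \<Rightarrow> ('w \<Rightarrow> real) \<Rightarrow> 'w \<Rightarrow> real" where
  "corrected_measurement M t_soil T w =
     measurement t_soil T w - prob_space.expectation M T"

definition sensing_error :: "'w measure \<Rightarrow> real \<Rightarrow> ('w \<Rightarrow> real) \<Rightarrow> 'w \<Rightarrow> real" where
  "sensing_error M t_soil T w = corrected_measurement M t_soil T w - t_soil"

definition SOP :: "'w measure \<Rightarrow> real \<Rightarrow> ('w \<Rightarrow> real) \<Rightarrow> real \<Rightarrow> real" where
  "SOP M t_soil T \<tau> = measure M {w \<in> space M. \<bar>sensing_error M t_soil T w\<bar> > \<tau>}"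

definition central_moment :: "'w measure \<Rightarrow> ('w \<Rightarrow> real) \<Rightarrow> nat \<Rightarrow> real" where
  "central_moment M T n =
     prob_space.expectation M (\<lambda>w. (T w - prob_space.expectation M T) ^ n)"

end

theory Submission
  imports Defs
begin

text \<open>Markov's inequality for \<open>f ^ n\<close> is strict because \<open>f ^ n\<close> exceeds \<open>\<tau> ^ n\<close> times the indicator of
  \<open>\<bar>f\<bar> > \<tau>\<close> wherever \<open>f \<noteq> 0\<close>; so it suffices that the interference has finite moments and is not
  almost surely constant.  It vanishes when the point process is empty and is positive when there is
  a point with at least one transmitter and positive gain, both of positive probability.  Bounding the
  \<open>n\<close>th power of a sum of \<open>k\<close> nonnegative terms by \<open>k ^ n\<close> times the sum of the \<open>n\<close>th powers and
  factorising by independence reduces the moments of the interference to those of the Poisson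
  distribution and of the power gain, whose density is dominated by an exponential one.\<close>

section \<open>Strict Markov inequality for even powers\<close>

lemma (in finite_measure) even_power_Markov_strict:
  fixes f :: "'a \<Rightarrow> real"
  assumes f: "f \<in> borel_measurable M" and int: "integrable M (\<lambda>x. f x ^ n)"
    and n: "even n" "n > 0" and \<tau>: "\<tau> > 0" and nz: "\<not> (AE x in M. f x = 0)"
  shows "measure M {x \<in> space M. \<bar>f x\<bar> > \<tau>} < (\<integral>x. f x ^ n \<partial>M) / \<tau> ^ n"
proof -
  note f[measurable]
  define A where "A = {x \<in> space M. \<bar>f x\<bar> > \<tau>}"
  define D where "D x = f x ^ n - \<tau> ^ n * indicator A x" for x
  have A[measurable]: "A \<in> sets M" unfolding A_def by measurable
  have intA: "integrable M (\<lambda>x. \<tau> ^ n * indicator A x)"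
    using emeasure_finite by (intro integrable_mult_right integrable_real_indicator)
      (auto simp: less_top[symmetric])
  have intD: "integrable M D" unfolding D_def by (intro Bochner_Integration.integrable_diff int intA)
  \<comment> \<open>On \<open>A\<close> the gap \<open>D\<close> is positive because \<bar>f\<bar>
    exceeds \<tau>. Off \<open>A\<close> it equals \<open>f x ^ n\<close>, which for even positive
    \<open>n\<close> is nonnegative and vanishes only at zeros of \<open>f\<close>. Hence a zero
    integral of \<open>D\<close> would force \<open>f\<close> to vanish almost everywhere.\<close>
  have D_pos: "0 \<le> D x \<and> (D x = 0 \<longrightarrow> f x = 0)" if "x \<in> space M" for x
  proof (cases "x \<in> A")
    case True
    then have "\<tau> ^ n < \<bar>f x\<bar> ^ n" unfolding A_def using \<tau> n by (intro power_strict_mono) auto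
    then show ?thesis using True n by (simp add: D_def power_even_abs)
  next
    case False
    then show ?thesis using n by (simp add: D_def zero_le_even_power)
  qed
  have D_int: "integral\<^sup>L M D = (\<integral>x. f x ^ n \<partial>M) - \<tau> ^ n * measure M A"
    unfolding D_def using int intA sets.sets_into_space[OF A] by (simp add: Int_absorb2)
  have "integral\<^sup>L M D \<noteq> 0"
  proof
    assume "integral\<^sup>L M D = 0"
    then have "AE x in M. D x = 0"
      using integral_nonneg_eq_0_iff_AE[OF intD] D_pos by auto
    then have "AE x in M. f x = 0" by (rule AE_mp) (use D_pos in auto)
    with nz show False by blast
  qed
  moreover have "integral\<^sup>L M D \<ge> 0" using D_pos by (intro integral_nonneg_AE) auto
  ultimately have "\<tau> ^ n * measure M A < (\<integral>x. f x ^ n \<partial>M)" using D_int by linarith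
  then show ?thesis using \<tau> unfolding A_def[symmetric] by (simp add: pos_less_divide_eq mult.commute)
qed

section \<open>Sums with a random number of terms\<close>

text \<open>Every term is at most the maximum, and the \<open>n\<close>th power of the maximum is
  itself one of the summands on the right. Positivity of \<open>n\<close> settles the empty index
  set, where both sides are 0.\<close>

lemma sum_power_le_card_power:
  fixes a :: "'i \<Rightarrow> real"
  assumes "finite I" and nonneg: "\<And>i. i \<in> I \<Longrightarrow> a i \<ge> 0" and n: "n > 0"
  shows "(\<Sum>i\<in>I. a i) ^ n \<le> real (card I) ^ n * (\<Sum>i\<in>I. a i ^ n)"
proof (cases "I = {}")
  case False
  define m where "m = Max (a ` I)"
  obtain j where j: "j \<in> I" "m = a j"
    using Max_in[of "a ` I"] False assms(1) unfolding m_def by blast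
  have "(\<Sum>i\<in>I. a i) \<le> (\<Sum>i\<in>I. m)"
    using assms(1) by (intro sum_mono) (simp add: m_def)
  then have "(\<Sum>i\<in>I. a i) ^ n \<le> (real (card I) * m) ^ n"
    using nonneg by (intro power_mono sum_nonneg) auto
  also have "\<dots> = real (card I) ^ n * a j ^ n" by (simp add: power_mult_distrib j)
  also have "\<dots> \<le> real (card I) ^ n * (\<Sum>i\<in>I. a i ^ n)"
    using assms j by (intro mult_left_mono member_le_sum) auto
  finally show ?thesis .
qed (use n in \<open>simp add: power_0_left\<close>)

text \<open>Moves a random number of terms out of the summation range and into the summands, so that
  integral and series can be exchanged.\<close>

lemma suminf_ennreal_if_less:
  fixes f :: "nat \<Rightarrow> real"
  assumes "\<And>i. f i \<ge> 0"
  shows "(\<Sum>i. ennreal (if i < k then f i else 0)) = ennreal (\<Sum>i<k. f i)"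
proof -
  have "(\<Sum>i. ennreal (if i < k then f i else 0)) = (\<Sum>i<k. ennreal (if i < k then f i else 0))"
    by (rule suminf_finite) auto
  also have "\<dots> = ennreal (\<Sum>i<k. f i)" using assms by (simp add: sum_ennreal)
  finally show ?thesis .
qed

section \<open>Moments of the Poisson law and of the power gain\<close>

text \<open>For nonnegative \<open>x\<close>, a single term of the exponential series is at most the
  whole sum.\<close>

lemma power_le_fact_exp:
  fixes x :: real
  assumes "x \<ge> 0"
  shows "x ^ n \<le> fact n * exp x"
proof -
  have "x ^ n /\<^sub>R fact n \<le> (\<Sum>k. x ^ k /\<^sub>R fact k)"
    using sum_le_suminf[OF summable_exp_generic[of x], of "{n}"] assms by (simp add: divide_inverse)
  then show ?thesis by (simp add: exp_def field_simps)
qed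

text \<open>All powers are dominated by one exponential moment: \<open>exp (real k)\<close> merges
  with \<open>a ^ k\<close> into \<open>(a * exp 1) ^ k\<close>, which leaves a convergent
  exponential series.\<close>

lemma nn_integral_poisson_power_finite:
  assumes a: "a > 0"
  shows "(\<integral>\<^sup>+k. ennreal (real k ^ n) \<partial>measure_pmf (poisson_pmf a)) < \<infinity>"
proof -
  have "(\<integral>\<^sup>+k. ennreal (real k ^ n) \<partial>measure_pmf (poisson_pmf a))
      \<le> (\<integral>\<^sup>+k. ennreal (fact n * exp (real k)) \<partial>measure_pmf (poisson_pmf a))"
    by (intro nn_integral_mono ennreal_leI power_le_fact_exp) simp
  also have "\<dots> = (\<Sum>k. ennreal (fact n * exp (- a) * ((a * exp 1) ^ k /\<^sub>R fact k)))"
    using a by (simp add: nn_integral_measure_pmf nn_integral_count_space_nat field_simps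
        flip: ennreal_mult' exp_of_nat_mult)
  also have "\<dots> = ennreal (\<Sum>k. fact n * exp (- a) * ((a * exp 1) ^ k /\<^sub>R fact k))"
    using a by (intro suminf_ennreal2 summable_mult summable_exp_generic) auto
  finally show ?thesis by (rule le_less_trans) simp
qed

text \<open>The coefficients are those of the binomial series of \<open>(1 - x) powr (- m)\<close>, which has
  radius of convergence 1.\<close>

lemma pochhammer_bound:
  fixes m q :: real
  assumes q: "q > 1"
  obtains A where "A > 0" "\<And>k. \<bar>pochhammer m k\<bar> / fact k \<le> A * q ^ k"
proof -
  \<comment> \<open>The point \<open>- 1 / q\<close> lies inside the disc of convergence, so the
    terms of the series there are bounded by some \<open>A\<close>. Multiplying by
    \<open>q ^ k\<close> yields the claim.\<close>
  have "summable (\<lambda>k. ((- m) gchoose k) * (- 1 / q) ^ k)"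
    using q by (intro sums_summable[OF gen_binomial_real]) auto
  then have "Bseq (\<lambda>k. ((- m) gchoose k) * (- 1 / q) ^ k)"
    by (intro convergent_imp_Bseq) (auto simp: convergent_def dest: summable_LIMSEQ_zero)
  then obtain A where A: "A > 0" "\<And>k. norm (((- m) gchoose k) * (- 1 / q) ^ k) \<le> A"
    by (auto elim: BseqE)
  have "\<bar>pochhammer m k\<bar> / fact k \<le> A * q ^ k" for k
    using A(2)[of k] q by (simp add: gbinomial_pochhammer abs_mult power_divide power_abs field_simps)
  with A(1) show ?thesis using that by blast
qed

text \<open>Since \<open>pochhammer 1 k\<close> is \<open>fact k\<close>, the bound on
  \<open>pochhammer m k / fact k\<close> leaves the series of \<open>A * exp (q * x)\<close> as a
  majorant. That \<open>q\<close> may be taken arbitrarily close to 1 is what the domination of the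
  density relies on.\<close>

lemma hyp1F1_exp_bound:
  fixes m q :: real
  assumes q: "q > 1"
  obtains A where "A > 0" "\<And>x. x \<ge> 0 \<Longrightarrow> hyp1F1 m 1 x \<le> A * exp (q * x)"
proof -
  obtain A where A: "A > 0" "\<And>k. \<bar>pochhammer m k\<bar> / fact k \<le> A * q ^ k"
    using pochhammer_bound[OF q] by blast
  have "hyp1F1 m 1 x \<le> A * exp (q * x)" if x: "x \<ge> 0" for x
  proof -
    define b where "b k = A * ((q * x) ^ k /\<^sub>R fact k)" for k
    have le: "norm (pochhammer m k / pochhammer 1 k * x ^ k / fact k) \<le> b k" for k
    proof -
      have "\<bar>pochhammer m k\<bar> / fact k * (x ^ k / fact k) \<le> A * q ^ k * (x ^ k / fact k)"
        using x by (intro mult_right_mono A) auto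
      then show ?thesis using x
        by (simp add: b_def pochhammer_fact[symmetric] abs_mult power_mult_distrib field_simps)
    qed
    have sb: "summable b" unfolding b_def by (intro summable_mult summable_exp_generic)
    have "hyp1F1 m 1 x \<le> (\<Sum>k. b k)" unfolding hyp1F1_def
    proof (rule suminf_le[OF _ _ sb])
      show "pochhammer m k / pochhammer 1 k * x ^ k / fact k \<le> b k" for k
        using le[of k] unfolding real_norm_def by (rule order_trans[OF abs_ge_self])
      show "summable (\<lambda>k. pochhammer m k / pochhammer 1 k * x ^ k / fact k)"
        using sb le by (rule summable_comparison_test'[of b 0])
    qed
    also have "\<dots> = A * exp (q * x)" unfolding b_def exp_def
      by (intro suminf_mult summable_exp_generic)
    finally show ?thesis .
  qed
  with A(1) show ?thesis using that by blast
qed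

text \<open>In the shadowed Rician case the argument of \<open>hyp1F1\<close> is
  \<open>t / (2 * b0)\<close> scaled by a ratio below 1, so its growth, even with a factor
  \<open>q\<close> slightly above 1, cannot cancel the decay of
  \<open>exp (- t / (2 * b0))\<close>.\<close>

lemma power_gain_density_le_exponential:
  assumes "valid_channel ch"
  obtains A \<delta> where "A > 0" "\<delta> > 0" "\<And>t. power_gain_density ch t \<le> A * exponential_density \<delta> t"
proof (cases ch)
  case (Rayleigh b0)
  with assms show ?thesis by (intro that[of 1 "1 / (2 * b0)"]) auto
next
  case (Shadowed_Rician \<Omega> b0 m)
  with assms have pos: "\<Omega> > 0" "b0 > 0" "m > 0" by auto
  define S where "S = 2 * b0 * m + \<Omega>"
  \<comment> \<open>The midpoint of 1 and \<open>S / \<Omega>\<close>: above 1, as the bound on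
    \<open>hyp1F1\<close> demands, yet with \<open>q * \<Omega> < S\<close>, so that the remaining
    decay rate \<delta> is positive.\<close>
  define q where "q = (1 + S / \<Omega>) / 2"
  define \<delta> where "\<delta> = (1 - q * \<Omega> / S) / (2 * b0)"
  have S: "S > \<Omega>" using pos by (simp add: S_def)
  have q: "q > 1" using S pos by (simp add: q_def field_simps)
  have "q * \<Omega> < S" using S pos by (simp add: q_def field_simps)
  then have \<delta>: "\<delta> > 0" using S pos by (simp add: \<delta>_def)
  obtain A where A: "A > 0" "\<And>x. x \<ge> 0 \<Longrightarrow> hyp1F1 m 1 x \<le> A * exp (q * x)"
    using hyp1F1_exp_bound[OF q] by blast
  define c where "c = 1 / (2 * b0) * (2 * b0 * m / S) powr m"
  have c: "c > 0" using pos S by (simp add: c_def)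
  show ?thesis
  \<comment> \<open>Dividing by \<delta> cancels the normalising factor of the exponential
    density.\<close>
  proof (rule that[of "c * A / \<delta>" \<delta>])
    show "c * A / \<delta> > 0" using c A \<delta> by simp
    fix t :: real
    show "power_gain_density ch t \<le> c * A / \<delta> * exponential_density \<delta> t"
    proof (cases "t > 0")
      case True
      have "power_gain_density ch t = c * exp (- t / (2 * b0)) * hyp1F1 m 1 (\<Omega> * t / (2 * b0 * S))"
        using True by (simp add: Shadowed_Rician c_def S_def)
      also have "\<dots> \<le> c * exp (- t / (2 * b0)) * (A * exp (q * (\<Omega> * t / (2 * b0 * S))))"
        using True pos S c by (intro mult_left_mono A) auto
      also have "\<dots> = c * A * exp (- t / (2 * b0) + q * (\<Omega> * t / (2 * b0 * S)))"
        by (simp only: exp_add mult.assoc mult.left_commute)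
      also have "- t / (2 * b0) + q * (\<Omega> * t / (2 * b0 * S)) = - t * \<delta>"
        using pos S by (simp add: \<delta>_def field_simps)
      finally show ?thesis using True \<delta> by (simp add: exponential_density_def)
    next
      case False
      then show ?thesis using c A \<delta> by (simp add: Shadowed_Rician)
    qed
  qed (use \<delta> in auto)
qed

lemma nn_integral_power_gain_density_power_finite:
  assumes "valid_channel ch"
  shows "(\<integral>\<^sup>+t. ennreal (power_gain_density ch t) * ennreal (t ^ n) \<partial>lborel) < \<infinity>"
proof -
  obtain A \<delta> where A: "A > 0" "\<delta> > 0" "\<And>t. power_gain_density ch t \<le> A * exponential_density \<delta> t"
    using power_gain_density_le_exponential[OF assms] by blast
  have "ennreal (power_gain_density ch t) * ennreal (t ^ n)
      \<le> ennreal A * ennreal (exponential_density \<delta> t * t ^ n)" for t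
  proof -
    have "ennreal (power_gain_density ch t) * ennreal (t ^ n)
        \<le> ennreal (A * exponential_density \<delta> t) * ennreal (t ^ n)"
      by (intro mult_right_mono ennreal_leI A) auto
    also have "\<dots> = ennreal A * ennreal (exponential_density \<delta> t * t ^ n)"
      using A by (simp add: ennreal_mult' mult.assoc)
    finally show ?thesis .
  qed
  then have "(\<integral>\<^sup>+t. ennreal (power_gain_density ch t) * ennreal (t ^ n) \<partial>lborel)
      \<le> (\<integral>\<^sup>+t. ennreal A * ennreal (exponential_density \<delta> t * t ^ n) \<partial>lborel)"
    by (rule nn_integral_mono)
  \<comment> \<open>The exponential density is the Erlang density of index 0, whose
    \<open>n\<close>th moment is known.\<close>
  also have "\<dots> = ennreal A * ennreal (fact (0 + n) / (fact 0 * \<delta> ^ n))"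
    using A by (subst nn_integral_cmult) (simp_all add: nn_integral_erlang_ith_moment)
  also have "\<dots> < \<infinity>" by (simp add: ennreal_mult_less_top)
  finally show ?thesis .
qed

section \<open>Independence and moments of the random double sum\<close>

lemma (in prob_space) nn_integral_source_product:
  fixes f g :: "nat \<Rightarrow> ennreal" and p :: "real \<Rightarrow> ennreal"
  assumes indep: "indep_sets (source_events M K X N H) UNIV"
    and K[measurable]: "K \<in> measurable M (count_space UNIV)"
    and N[measurable]: "N i \<in> measurable M (count_space UNIV)"
    and G[measurable]: "power_gain H i j \<in> borel_measurable M"
    and p[measurable]: "p \<in> borel_measurable borel"
  shows "(\<integral>\<^sup>+w. f (K w) * g (N i w) * p (power_gain H i j w) \<partial>M) =
    (\<integral>\<^sup>+w. f (K w) \<partial>M) * (\<integral>\<^sup>+w. g (N i w) \<partial>M) * (\<integral>\<^sup>+w. p (power_gain H i j w) \<partial>M)"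
proof -
  \<comment> \<open>The sources have different value types. \<open>Z\<close> maps each of them into
    \<open>ennreal\<close>, so that the product rule for independent variables applies to the three
    sources in \<open>I\<close>.\<close>
  define Z where "Z s w = (case s of Points \<Rightarrow> f (K w) | Num a \<Rightarrow> g (N a w)
      | Gain a b \<Rightarrow> p (power_gain H a b w))" for s w
  define I where "I = {Points, Num i, Gain i j}"
  have "{Z s -` A \<inter> space M |A. A \<in> sets borel} \<subseteq> source_events M K X N H s" for s
  proof (cases s)
    case Points
    have "Z s -` A \<inter> space M \<in> source_events M K X N H s" for A
    proof -
      \<comment> \<open>An event about \<open>K\<close> alone is the preimage of a rectangle with
        full second side, hence an event of the source \<open>Points\<close>.\<close>
      have "(\<lambda>w. (K w, \<lambda>i. X i w)) -` ((f -` A) \<times> UNIV) \<inter> space M \<in> source_events M K X N H Points"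
        unfolding source_events.simps
        by (intro in_vimage_algebra pair_measureI)
          (auto simp: space_PiM intro!: sets.top[of "\<Pi>\<^sub>M i\<in>UNIV. borel", simplified space_PiM, simplified])
      also have "(\<lambda>w. (K w, \<lambda>i. X i w)) -` ((f -` A) \<times> UNIV) \<inter> space M = Z s -` A \<inter> space M"
        by (auto simp: Z_def Points)
      finally show ?thesis by (simp add: Points)
    qed
    then show ?thesis by auto
  next
    case (Num a)
    have "Z s -` A \<inter> space M = N a -` (g -` A) \<inter> space M" for A by (auto simp: Z_def Num)
    then show ?thesis by (auto simp: Num intro!: in_vimage_algebra)
  next
    case (Gain a b)
    have "Z s -` A \<inter> space M = power_gain H a b -` (p -` A) \<inter> space M" for A
      by (auto simp: Z_def Gain)
    then show ?thesis using measurable_sets[OF p] by (auto simp: Gain intro!: in_vimage_algebra)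
  qed
  then have "indep_sets (\<lambda>s. {Z s -` A \<inter> space M |A. A \<in> sets borel}) I"
    by (intro indep_sets_mono[OF indep]) auto
  moreover have "Z s \<in> borel_measurable M" if "s \<in> I" for s
    using that by (auto simp: I_def Z_def[abs_def])
  ultimately have "indep_vars (\<lambda>_. borel) Z I" by (auto simp: indep_vars_def2)
  then have "(\<integral>\<^sup>+w. (\<Prod>s\<in>I. Z s w) \<partial>M) = (\<Prod>s\<in>I. \<integral>\<^sup>+w. Z s w \<partial>M)"
    by (intro indep_vars_nn_integral) (auto simp: I_def)
  then show ?thesis by (simp add: I_def Z_def mult.assoc)
qed

text \<open>Applying the power-sum bound to the outer and to the inner sum gives a double series of
  products, each of which factorises by independence. Since the moments \<open>q\<close> and
  \<open>m\<close> are the same for all indices, they can be pulled out of the series.\<close>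

lemma (in prob_space) nn_integral_random_double_sum_power_finite:
  assumes indep: "indep_sets (source_events M K X N H) UNIV"
    and K[measurable]: "K \<in> measurable M (count_space UNIV)"
    and N[measurable]: "\<And>i. N i \<in> measurable M (count_space UNIV)"
    and G[measurable]: "\<And>i j. power_gain H i j \<in> borel_measurable M"
    and n: "n > 0"
    and K_moment: "(\<integral>\<^sup>+w. ennreal (real (K w) ^ Suc n) \<partial>M) < \<infinity>"
    and N_moment: "\<And>i. (\<integral>\<^sup>+w. ennreal (real (N i w) ^ Suc n) \<partial>M) = q" "q < \<infinity>"
    and G_moment: "\<And>i j. (\<integral>\<^sup>+w. ennreal (power_gain H i j w ^ n) \<partial>M) = m" "m < \<infinity>"
  shows "(\<integral>\<^sup>+w. ennreal ((\<Sum>i<K w. \<Sum>j<N i w. power_gain H i j w) ^ n) \<partial>M) < \<infinity>"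
proof -
  \<comment> \<open>\<open>f i k\<close> carries both the cutoff \<open>i < k\<close> and the factor
    \<open>k ^ n\<close> of the power-sum bound, for \<open>K\<close> as well as for
    \<open>N i\<close>. Summing over \<open>i\<close> adds one more factor \<open>k\<close>, which
    is why moments of order \<open>Suc n\<close> of the counts appear.\<close>
  define f where "f i k = ennreal (if i < k then real k ^ n else 0)" for i k :: nat
  have sum_f: "(\<Sum>i. f i k) = ennreal (real k ^ Suc n)" for k
    unfolding f_def by (subst suminf_ennreal_if_less) simp_all
  have G0: "power_gain H i j w \<ge> 0" for i j w by (simp add: power_gain_def)
  have bound: "ennreal ((\<Sum>i<K w. \<Sum>j<N i w. power_gain H i j w) ^ n)
      \<le> (\<Sum>i. \<Sum>j. f i (K w) * f j (N i w) * ennreal (power_gain H i j w ^ n))" for w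
  proof -
    define S where "S i = (\<Sum>j<N i w. power_gain H i j w)" for i
    define R where "R i = real (N i w) ^ n * (\<Sum>j<N i w. power_gain H i j w ^ n)" for i
    have S0: "S i \<ge> 0" and R0: "R i \<ge> 0" for i
      unfolding S_def R_def by (intro sum_nonneg mult_nonneg_nonneg; simp add: G0)+
    have SR: "S i ^ n \<le> R i" for i
      unfolding S_def R_def
      using sum_power_le_card_power[of "{..<N i w}" "\<lambda>j. power_gain H i j w" n] n G0 by simp
    have "(\<Sum>i<K w. S i) ^ n \<le> real (K w) ^ n * (\<Sum>i<K w. S i ^ n)"
      using sum_power_le_card_power[of "{..<K w}" S n] n S0 by simp
    also have "\<dots> \<le> real (K w) ^ n * (\<Sum>i<K w. R i)"
      by (intro mult_left_mono sum_mono SR) simp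
    also have "\<dots> = (\<Sum>i<K w. real (K w) ^ n * R i)" by (simp add: sum_distrib_left)
    finally have "ennreal ((\<Sum>i<K w. S i) ^ n) \<le> ennreal (\<Sum>i<K w. real (K w) ^ n * R i)"
      by (rule ennreal_leI)
    also have "\<dots> = (\<Sum>i. ennreal (if i < K w then real (K w) ^ n * R i else 0))"
      using R0 by (subst suminf_ennreal_if_less) auto
    also have "\<dots> = (\<Sum>i. f i (K w) * ennreal (R i))"
      by (intro suminf_cong) (auto simp: f_def ennreal_mult R0)
    also have "\<dots> = (\<Sum>i. \<Sum>j. f i (K w) * f j (N i w) * ennreal (power_gain H i j w ^ n))"
    proof (intro suminf_cong)
      fix i
      have "ennreal (R i)
          = (\<Sum>j. ennreal (if j < N i w then real (N i w) ^ n * power_gain H i j w ^ n else 0))"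
        using G0 by (subst suminf_ennreal_if_less) (auto simp: R_def sum_distrib_left)
      also have "\<dots> = (\<Sum>j. f j (N i w) * ennreal (power_gain H i j w ^ n))"
        by (intro suminf_cong) (auto simp: f_def ennreal_mult G0)
      finally show "f i (K w) * ennreal (R i)
          = (\<Sum>j. f i (K w) * f j (N i w) * ennreal (power_gain H i j w ^ n))"
        by (simp add: mult.assoc)
    qed
    finally show ?thesis unfolding S_def .
  qed
  have "(\<integral>\<^sup>+w. ennreal ((\<Sum>i<K w. \<Sum>j<N i w. power_gain H i j w) ^ n) \<partial>M)
      \<le> (\<integral>\<^sup>+w. (\<Sum>i. \<Sum>j. f i (K w) * f j (N i w) * ennreal (power_gain H i j w ^ n)) \<partial>M)"
    by (intro nn_integral_mono bound)
  also have "\<dots> = (\<Sum>i. \<Sum>j. \<integral>\<^sup>+w. f i (K w) * f j (N i w) * ennreal (power_gain H i j w ^ n) \<partial>M)"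
    by (simp add: nn_integral_suminf)
  also have "\<dots> = (\<Sum>i. \<Sum>j. (\<integral>\<^sup>+w. f i (K w) \<partial>M) * (\<integral>\<^sup>+w. f j (N i w) \<partial>M) * m)"
    by (intro suminf_cong, subst nn_integral_source_product[OF indep, where p = "\<lambda>x. ennreal (x ^ n)"])
      (simp_all add: G_moment)
  also have "\<dots> = (\<Sum>i. (\<integral>\<^sup>+w. f i (K w) \<partial>M) * (\<Sum>j. \<integral>\<^sup>+w. f j (N i w) \<partial>M) * m)" by simp
  also have "\<dots> = (\<Sum>i. (\<integral>\<^sup>+w. f i (K w) \<partial>M) * q * m)"
  proof (intro suminf_cong)
    fix i
    have "(\<Sum>j. \<integral>\<^sup>+w. f j (N i w) \<partial>M) = q"
      by (subst nn_integral_suminf[symmetric]) (simp_all only: sum_f N_moment, measurable)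
    then show "(\<integral>\<^sup>+w. f i (K w) \<partial>M) * (\<Sum>j. \<integral>\<^sup>+w. f j (N i w) \<partial>M) * m
        = (\<integral>\<^sup>+w. f i (K w) \<partial>M) * q * m" by simp
  qed
  also have "\<dots> = (\<Sum>i. \<integral>\<^sup>+w. f i (K w) \<partial>M) * q * m" by simp
  also have "(\<Sum>i. \<integral>\<^sup>+w. f i (K w) \<partial>M) = (\<integral>\<^sup>+w. ennreal (real (K w) ^ Suc n) \<partial>M)"
    by (subst nn_integral_suminf[symmetric]) (simp_all only: sum_f, measurable)
  also have "\<dots> * q * m < \<infinity>"
    using K_moment N_moment(2) G_moment(2) by (simp add: ennreal_mult_less_top)
  finally show ?thesis .
qed

section \<open>Laws of the counts and null events\<close>

text \<open>All enumerated points lie in \<open>B\<close>, so \<open>K\<close> is the point count of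
  \<open>B\<close> itself.\<close>

lemma homogeneous_ppp_count_distr:
  assumes "prob_space M" and ppp: "homogeneous_ppp M r B c K X" and B: "B \<in> sets borel"
    and c: "c > 0" and area: "measure (sphere_area r) B > 0"
  shows "distr M (count_space UNIV) K = measure_pmf (poisson_pmf (c * measure (sphere_area r) B))"
proof (rule measure_eqI_countable)
  interpret prob_space M by fact
  define a where "a = c * measure (sphere_area r) B"
  have a: "a > 0" using c area by (simp add: a_def)
  have K: "K \<in> measurable M (count_space UNIV)" using ppp by (simp add: homogeneous_ppp_def)
  fix k
  have "point_count K X B w = K w" if "w \<in> space M" for w
  proof -
    have "{i. i < K w \<and> X i w \<in> B} = {..<K w}" using ppp that by (auto simp: homogeneous_ppp_def)
    then show ?thesis by (simp add: point_count_def)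
  qed
  then have "K -` {k} \<inter> space M = {w \<in> space M. point_count K X B w = k}" by auto
  moreover have "measure M {w \<in> space M. point_count K X B w = k} = a ^ k / fact k * exp (- a)"
    using ppp B unfolding homogeneous_ppp_def a_def by blast
  ultimately show "emeasure (distr M (count_space UNIV) K) {k}
      = emeasure (measure_pmf (poisson_pmf (c * measure (sphere_area r) B))) {k}"
    unfolding a_def[symmetric] using K a
    by (simp add: emeasure_distr emeasure_eq_measure emeasure_pmf_single)
qed auto

text \<open>Binomial expansion; the zeroth power is the constant 1, integrable under a probability
  measure.\<close>

lemma (in prob_space) integrable_centered_power:
  fixes T :: "'a \<Rightarrow> real"
  assumes "\<And>k. 0 < k \<Longrightarrow> k \<le> n \<Longrightarrow> integrable M (\<lambda>w. T w ^ k)"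
  shows "integrable M (\<lambda>w. (T w - c) ^ n)"
proof -
  have "(\<lambda>w. (T w - c) ^ n) = (\<lambda>w. \<Sum>k\<le>n. of_nat (n choose k) * T w ^ k * (- c) ^ (n - k))"
    using binomial_ring[of "T _" "- c" n] by auto
  moreover have "integrable M (\<lambda>w. T w ^ k)" if "k \<le> n" for k
    using assms[of k] that by (cases k) auto
  ultimately show ?thesis by auto
qed

text \<open>At a positive rate every natural number has positive mass, so a single witness
  \<open>k\<close> suffices.\<close>

lemma (in prob_space) poisson_not_AE:
  assumes Y: "Y \<in> measurable M (count_space UNIV)"
    and distr: "distr M (count_space UNIV) Y = measure_pmf (poisson_pmf a)" and a: "a > 0"
    and k: "P k"
  shows "\<not> (AE w in M. \<not> P (Y w))"
proof
  assume "AE w in M. \<not> P (Y w)"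
  then have "AE k in measure_pmf (poisson_pmf a). \<not> P k"
    unfolding distr[symmetric] by (subst AE_distr_iff[OF Y]) auto
  then show False using a k by (auto simp: AE_measure_pmf_iff)
qed

text \<open>A law with a Lebesgue density has no atom at 0.\<close>

lemma (in prob_space) power_gain_AE_nonzero:
  assumes "distributed M lborel (power_gain H i j) d"
  shows "AE w in M. power_gain H i j w \<noteq> 0"
proof -
  have meas: "power_gain H i j \<in> measurable M lborel"
    using distributed_measurable[OF assms] .
  have "AE t in density lborel d. t \<noteq> (0::real)"
    using distributed_borel_measurable[OF assms] AE_lborel_singleton[of 0]
    by (subst AE_density) auto
  then have "AE t in distr M lborel (power_gain H i j). t \<noteq> 0"
    unfolding distributed_distr_eq_density[OF assms] .
  then show ?thesis by (subst (asm) AE_distr_iff[OF meas]) auto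
qed

theorem mainTheorem9:
  fixes M :: "'w measure"
    and \<omega> \<alpha> lambda_c lambda_BS g_sl r_e h t_soil \<tau> :: real
    and B_sl :: "(real ^ 3) set"
    and K :: "'w \<Rightarrow> nat"
    and X :: "nat \<Rightarrow> 'w \<Rightarrow> real ^ 3"
    and N :: "nat \<Rightarrow> 'w \<Rightarrow> nat"
    and H :: "nat \<Rightarrow> nat \<Rightarrow> 'w \<Rightarrow> complex"
    and ch :: channel
    and n :: nat
  defines "T_sl \<equiv> sidelobe_rfi g_sl \<omega> \<alpha> h K X N H"
  assumes "prob_space M"
    and "\<omega> > 0" and "\<alpha> > 2" and "lambda_c > 0" and "lambda_BS > 0" and "g_sl > 0"
    and "h > r_e" and "r_e > 0"
    and "B_sl \<in> sets borel" and "B_sl \<subseteq> exposed_cap r_e h"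
    and "measure (sphere_area r_e) B_sl > 0"
    and "homogeneous_ppp M r_e B_sl lambda_c K X"
    and "\<And>i. N i \<in> measurable M (count_space UNIV)"
    and "\<And>i. distr M (count_space UNIV) (N i) = measure_pmf (poisson_pmf lambda_BS)"
    and "valid_channel ch"
    and "\<And>i j. distributed M lborel (power_gain H i j) (power_gain_density ch)"
    and "prob_space.indep_sets M (source_events M K X N H) UNIV"
    and "\<tau> > 0" and "even n" and "n > 0"
  shows "SOP M t_soil T_sl \<tau> =
           measure M {w \<in> space M. \<bar>T_sl w - prob_space.expectation M T_sl\<bar> > \<tau>}
       \<and> measure M {w \<in> space M. \<bar>T_sl w - prob_space.expectation M T_sl\<bar> > \<tau>}
           < central_moment M T_sl n / \<tau> ^ n"
proof -
  interpret prob_space M by fact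

  \<comment> \<open>Measurability and size of the interference\<close>
  define G where "G = power_gain H"
  \<comment> \<open>\<open>D\<close> is the weight of a point and \<open>C\<close> bounds it, since
    points on the Earth are at least \<open>h - r_e\<close> away from the satellite.
    \<open>V\<close> drops the weights: by \<open>T_sl w \<le> C * V w\<close> the positions of the
    points leave the moment estimates.\<close>
  define D where "D i w = g_sl * \<omega> * norm (X i w - satellite h) powr (- \<alpha>)" for i w
  define C where "C = g_sl * \<omega> * (h - r_e) powr (- \<alpha>)"
  define V where "V w = (\<Sum>i<K w. \<Sum>j<N i w. G i j w)" for w
  note N_meas[measurable] = \<open>\<And>i. N i \<in> measurable M (count_space UNIV)\<close>
  note gain = \<open>\<And>i j. distributed M lborel (power_gain H i j) (power_gain_density ch)\<close>
  note indep = \<open>indep_sets (source_events M K X N H) UNIV\<close>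
  note ppp = \<open>homogeneous_ppp M r_e B_sl lambda_c K X\<close>
  have K_meas[measurable]: "K \<in> measurable M (count_space UNIV)"
    and X_meas[measurable]: "\<And>i. X i \<in> borel_measurable M"
    and X_B: "\<And>w i. w \<in> space M \<Longrightarrow> i < K w \<Longrightarrow> X i w \<in> B_sl"
    using ppp by (auto simp: homogeneous_ppp_def)
  have G_meas[measurable]: "G i j \<in> borel_measurable M" for i j
    using distributed_measurable[OF gain, of i j] by (simp add: G_def)
  have G0: "G i j w \<ge> 0" for i j w by (simp add: G_def power_gain_def)
  have V0: "V w \<ge> 0" for w unfolding V_def by (intro sum_nonneg G0)
  have T_eq: "T_sl w = (\<Sum>i<K w. D i w * (\<Sum>j<N i w. G i j w))" for w
    unfolding T_sl_def sidelobe_rfi_def D_def G_def by (simp add: sum_distrib_left mult_ac)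
  have T_meas[measurable]: "T_sl \<in> borel_measurable M"
  proof -
    \<comment> \<open>The sum is measurable for each fixed number of terms, and that number takes
      countably many values.\<close>
    have [measurable]: "(\<lambda>w. \<Sum>j<N i w. G i j w) \<in> borel_measurable M" for i
      by (rule measurable_compose_countable[where f = "\<lambda>k w. \<Sum>j<k. G i j w"]) measurable
    have "(\<lambda>w. \<Sum>i<K w. D i w * (\<Sum>j<N i w. G i j w)) \<in> borel_measurable M"
      unfolding D_def
      by (rule measurable_compose_countable[where
            f = "\<lambda>k w. \<Sum>i<k. g_sl * \<omega> * norm (X i w - satellite h) powr (- \<alpha>) * (\<Sum>j<N i w. G i j w)"])
        measurable
    then show ?thesis by (simp add: T_eq[abs_def])
  qed
  have norm_sat: "norm (satellite h) = h"
    using \<open>h > r_e\<close> \<open>r_e > 0\<close> by (simp add: satellite_def norm_eq_sqrt_inner inner_vec_def sum_3)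
  have dist: "norm (X i w - satellite h) \<ge> h - r_e" if "w \<in> space M" "i < K w" for i w
    using norm_triangle_ineq2[of "satellite h" "X i w"] X_B[OF that] \<open>B_sl \<subseteq> exposed_cap r_e h\<close>
    by (auto simp: norm_sat norm_minus_commute exposed_cap_def)
  have D_pos: "D i w > 0" and D_le: "D i w \<le> C" if "w \<in> space M" "i < K w" for i w
  proof -
    show "D i w > 0"
      using dist[OF that] \<open>h > r_e\<close> \<open>g_sl > 0\<close> \<open>\<omega> > 0\<close> unfolding D_def by (intro mult_pos_pos) auto
    have "norm (X i w - satellite h) powr (- \<alpha>) \<le> (h - r_e) powr (- \<alpha>)"
      using dist[OF that] \<open>h > r_e\<close> \<open>\<alpha> > 2\<close> by (intro powr_mono2') auto
    then show "D i w \<le> C"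
      using \<open>g_sl > 0\<close> \<open>\<omega> > 0\<close> unfolding D_def C_def by (intro mult_left_mono) auto
  qed
  have T0: "T_sl w \<ge> 0" if "w \<in> space M" for w
    unfolding T_eq using D_pos[OF that] by (intro sum_nonneg mult_nonneg_nonneg G0) (auto intro: less_imp_le)
  have T_le: "T_sl w \<le> C * V w" if "w \<in> space M" for w
    unfolding T_eq V_def using D_le[OF that]
    by (subst sum_distrib_left) (auto intro!: sum_mono mult_right_mono sum_nonneg G0)

  \<comment> \<open>Finiteness of the moments\<close>
  define a where "a = lambda_c * measure (sphere_area r_e) B_sl"
  have a: "a > 0"
    using \<open>lambda_c > 0\<close> \<open>measure (sphere_area r_e) B_sl > 0\<close> by (simp add: a_def)
  have K_distr: "distr M (count_space UNIV) K = measure_pmf (poisson_pmf a)"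
    unfolding a_def
    by (rule homogeneous_ppp_count_distr[OF \<open>prob_space M\<close> ppp \<open>B_sl \<in> sets borel\<close> \<open>lambda_c > 0\<close>
          \<open>measure (sphere_area r_e) B_sl > 0\<close>])
  have moment: "(\<integral>\<^sup>+w. ennreal (real (Y w) ^ p) \<partial>M)
      = (\<integral>\<^sup>+k. ennreal (real k ^ p) \<partial>measure_pmf (poisson_pmf b))"
    if "Y \<in> measurable M (count_space UNIV)"
      "distr M (count_space UNIV) Y = measure_pmf (poisson_pmf b)" for Y b p
    using that(1) unfolding that(2)[symmetric] by (subst nn_integral_distr) auto
  have V_moment: "(\<integral>\<^sup>+w. ennreal (V w ^ k) \<partial>M) < \<infinity>" if "k > 0" for k
    unfolding V_def G_def
  proof (rule nn_integral_random_double_sum_power_finite[OF indep K_meas N_meas _ that])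
    show "power_gain H i j \<in> borel_measurable M" for i j using G_meas by (simp add: G_def)
    show "(\<integral>\<^sup>+w. ennreal (real (K w) ^ Suc k) \<partial>M) < \<infinity>"
      unfolding moment[OF K_meas K_distr] by (rule nn_integral_poisson_power_finite[OF a])
    show "(\<integral>\<^sup>+w. ennreal (real (N i w) ^ Suc k) \<partial>M)
        = (\<integral>\<^sup>+l. ennreal (real l ^ Suc k) \<partial>measure_pmf (poisson_pmf lambda_BS))" for i
      by (rule moment) fact+
    show "(\<integral>\<^sup>+l. ennreal (real l ^ Suc k) \<partial>measure_pmf (poisson_pmf lambda_BS)) < \<infinity>"
      by (rule nn_integral_poisson_power_finite) fact
    show "(\<integral>\<^sup>+w. ennreal (power_gain H i j w ^ k) \<partial>M)
        = (\<integral>\<^sup>+t. ennreal (power_gain_density ch t) * ennreal (t ^ k) \<partial>lborel)" for i j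
      by (rule distributed_nn_integral[OF gain, symmetric]) measurable
    show "(\<integral>\<^sup>+t. ennreal (power_gain_density ch t) * ennreal (t ^ k) \<partial>lborel) < \<infinity>"
      by (rule nn_integral_power_gain_density_power_finite) fact
  qed
  have T_int: "integrable M (\<lambda>w. T_sl w ^ k)" if "k > 0" for k
  proof (rule integrableI_bounded)
    have "(\<integral>\<^sup>+w. ennreal (norm (T_sl w ^ k)) \<partial>M) \<le> (\<integral>\<^sup>+w. ennreal (C ^ k) * ennreal (V w ^ k) \<partial>M)"
    proof (rule nn_integral_mono)
      fix w assume w: "w \<in> space M"
      have "T_sl w ^ k \<le> (C * V w) ^ k" using T0[OF w] T_le[OF w] by (intro power_mono)
      then show "ennreal (norm (T_sl w ^ k)) \<le> ennreal (C ^ k) * ennreal (V w ^ k)"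
        using T0[OF w] V0[of w] by (simp add: power_mult_distrib ennreal_leI flip: ennreal_mult'')
    qed
    also have "\<dots> = ennreal (C ^ k) * (\<integral>\<^sup>+w. ennreal (V w ^ k) \<partial>M)"
    proof (rule nn_integral_cmult)
      have [measurable]: "(\<lambda>w. \<Sum>j<N i w. G i j w) \<in> borel_measurable M" for i
        by (rule measurable_compose_countable[where f = "\<lambda>k w. \<Sum>j<k. G i j w"]) measurable
      have "V \<in> borel_measurable M" unfolding V_def[abs_def]
        by (rule measurable_compose_countable[where f = "\<lambda>k w. \<Sum>i<k. \<Sum>j<N i w. G i j w"]) measurable
      then show "(\<lambda>w. ennreal (V w ^ k)) \<in> borel_measurable M" by measurable
    qed
    also have "\<dots> < \<infinity>" using V_moment[OF that] by (simp add: ennreal_mult_less_top)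
    finally show "(\<integral>\<^sup>+w. ennreal (norm (T_sl w ^ k)) \<partial>M) < \<infinity>" .
  qed measurable

  \<comment> \<open>The interference is not almost surely constant\<close>
  have nonconst: "\<not> (AE w in M. T_sl w - \<mu> = 0)" for \<mu>
  proof
    assume AE_\<mu>: "AE w in M. T_sl w - \<mu> = 0"
    \<comment> \<open>With positive probability there are no points, and then the interference is 0;
      this is the only possible constant.\<close>
    have "\<mu> = 0"
    proof (rule ccontr)
      assume "\<mu> \<noteq> 0"
      have "AE w in M. \<not> K w = 0"
        using AE_\<mu> by eventually_elim (use \<open>\<mu> \<noteq> 0\<close> in \<open>auto simp: T_eq intro!: gr0I\<close>)
      then show False using poisson_not_AE[OF K_meas K_distr a, of "\<lambda>k. k = 0" 0] by simp
    qed
    \<comment> \<open>The summand for point 0 and transmitter 0 alone makes the sum positive, as all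
      others are nonnegative.\<close>
    have pos: "T_sl w > 0" if w: "w \<in> space M" and "K w > 0" "N 0 w > 0" "G 0 0 w > 0" for w
    proof -
      have "0 < (\<Sum>j<N 0 w. G 0 j w)" using that by (intro sum_pos2[of _ 0] G0) auto
      then have "0 < D 0 w * (\<Sum>j<N 0 w. G 0 j w)" using D_pos[OF w] that by simp
      then show ?thesis unfolding T_eq using that D_pos[OF w]
        by (intro sum_pos2[of _ 0] mult_nonneg_nonneg sum_nonneg G0) (auto intro: less_imp_le)
    qed
    \<comment> \<open>Indicators of positivity: \<open>f\<close> serves both counts and
      \<open>p\<close> the gain, so the probability of the joint event factorises.\<close>
    define f :: "nat \<Rightarrow> ennreal" where "f k = (if k > 0 then 1 else 0)" for k
    define p :: "real \<Rightarrow> ennreal" where "p x = (if x > 0 then 1 else 0)" for x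
    have p[measurable]: "p \<in> borel_measurable borel" unfolding p_def[abs_def] by measurable
    have "AE w in M. f (K w) * f (N 0 w) * p (G 0 0 w) = 0"
      using AE_\<mu>
    proof (rule AE_mp, intro AE_I2 impI)
      fix w assume "w \<in> space M" "T_sl w - \<mu> = 0"
      then show "f (K w) * f (N 0 w) * p (G 0 0 w) = 0"
        using pos[of w] \<open>\<mu> = 0\<close> by (auto simp: f_def p_def)
    qed
    then have "(\<integral>\<^sup>+w. f (K w) * f (N 0 w) * p (G 0 0 w) \<partial>M) = 0"
      by (subst nn_integral_0_iff_AE) auto
    then have "(\<integral>\<^sup>+w. f (K w) \<partial>M) * (\<integral>\<^sup>+w. f (N 0 w) \<partial>M) * (\<integral>\<^sup>+w. p (G 0 0 w) \<partial>M) = 0"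
      using nn_integral_source_product[OF indep K_meas N_meas _ p, of 0 0 f f] G_meas[of 0 0]
      by (simp add: G_def)
    \<comment> \<open>One of the three probabilities would be 0. The Poisson mass at 1 excludes this
      for the counts, and the absence of an atom at 0 excludes it for the nonnegative gain.\<close>
    then consider "(\<integral>\<^sup>+w. f (K w) \<partial>M) = 0" | "(\<integral>\<^sup>+w. f (N 0 w) \<partial>M) = 0" | "(\<integral>\<^sup>+w. p (G 0 0 w) \<partial>M) = 0"
      by auto
    then show False
    proof cases
      case 1
      then have "AE w in M. \<not> K w > 0" by (subst (asm) nn_integral_0_iff_AE) (auto simp: f_def)
      then show False using poisson_not_AE[OF K_meas K_distr a, of "\<lambda>k. k > 0" 1] by simp
    next
      case 2
      then have "AE w in M. \<not> N 0 w > 0" by (subst (asm) nn_integral_0_iff_AE) (auto simp: f_def)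
      then show False
        using poisson_not_AE[OF N_meas \<open>distr M (count_space UNIV) (N _) = _\<close> \<open>lambda_BS > 0\<close>,
            of "\<lambda>k. k > 0" 1 0] by simp
    next
      case 3
      then have "AE w in M. p (G 0 0 w) = 0" by (subst (asm) nn_integral_0_iff_AE) auto
      moreover have "AE w in M. G 0 0 w \<noteq> 0"
        unfolding G_def by (rule power_gain_AE_nonzero[OF gain])
      ultimately have "AE w in M. False"
        by eventually_elim (use G0[of 0 0] in \<open>auto simp: p_def less_le split: if_splits\<close>)
      then show False by simp
    qed
  qed

  \<comment> \<open>The bound for the centred interference\<close>
  have "SOP M t_soil T_sl \<tau> = measure M {w \<in> space M. \<bar>T_sl w - expectation T_sl\<bar> > \<tau>}"
    by (simp add: SOP_def sensing_error_def corrected_measurement_def measurement_def)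
  moreover have "measure M {w \<in> space M. \<bar>T_sl w - expectation T_sl\<bar> > \<tau>}
      < central_moment M T_sl n / \<tau> ^ n"
    unfolding central_moment_def
  \<comment> \<open>Here \<open>f\<close> is the centred interference; \<open>nonconst\<close> with
    \<mu> equal to the mean shows that it does not vanish almost surely.\<close>
  proof (rule even_power_Markov_strict)
    show "integrable M (\<lambda>w. (T_sl w - expectation T_sl) ^ n)"
      by (intro integrable_centered_power T_int)
  qed (use nonconst \<open>even n\<close> \<open>n > 0\<close> \<open>\<tau> > 0\<close> in auto)
  ultimately show ?thesis by blast
qed

end
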